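(* There exists a constant $c>0$ such that for every $\varepsilon\in(0,1)$ there exist a $K_5$-minor-free graph $G$ of treewidth at most $5$ and a set $P\subseteq V(G)$ such that any furthest neighbor $\varepsilon$-coreset for $P$ in the shortest-path metric of $G$ must have size at least $2^{c/\varepsilon}$.
   Context: Graphs are finite, and the metric considered is the shortest-path metric $(V(G),\mathrm{dist}_G)$. Given a metric space $(V,\mathrm{dist})$, a nonempty set $P\subseteq V$ and $\varepsilon>0$, a furthest neighbor $\varepsilon$-coreset for $P$ is a subset $Q\subseteq P$ such that for every $v\in V$ there exists $q\in Q$ with $\mathrm{dist}(v,q)\ge(1-\varepsilon)\max\{\mathrm{dist}(v,p): p\in P\}$. *)

theory Defs
  imports Complex_Main "Graph_Theory.Graph_Theory"
begin

text \<open>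
  A finite simple undirected graph is a symmetric \<^typ>\<open>'a pair_pre_digraph\<close>, i.e. an
  instance of the locale \<^locale>\<open>pair_graph\<close>. Note that \<^const>\<open>connected\<close>
  (here \<open>Digraph_Component.connected\<close>) includes non-emptiness of the vertex set.
\<close>

section \<open>Minors\<close>

text \<open>
  The function \<open>B\<close> is a minor model: it assigns a branch set to every vertex of \<open>H\<close>.
\<close>

definition is_minor :: "'a pair_pre_digraph \<Rightarrow> 'b pair_pre_digraph \<Rightarrow> bool" where
  "is_minor H G \<longleftrightarrow> (\<exists>B :: 'a \<Rightarrow> 'b set.
     (\<forall>x \<in> pverts H. B x \<subseteq> pverts G \<and> connected (with_proj G \<restriction> B x)) \<and>
     (\<forall>x \<in> pverts H. \<forall>y \<in> pverts H. x \<noteq> y \<longrightarrow> B x \<inter> B y = {}) \<and>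
     (\<forall>(x, y) \<in> parcs H. \<exists>u \<in> B x. \<exists>v \<in> B y. (u, v) \<in> parcs G))"

definition complete_minor_free :: "nat \<Rightarrow> 'a pair_pre_digraph \<Rightarrow> bool" where
  "complete_minor_free n G \<longleftrightarrow>
     \<not> (\<exists>H :: nat pair_pre_digraph. K\<^bsub>n\<^esub> (with_proj H) \<and> is_minor H G)"

section \<open>Treewidth\<close>

text \<open>
  The predicate \<open>Digraph_Component.tree\<close> is not usable for symmetric digraphs, where
  traversing an edge back and forth is a \<^const>\<open>pre_digraph.cycle\<close> of length 2. The cycles
  of an undirected simple graph are those of length at least 3.
\<close>

definition undirected_tree :: "'a pair_pre_digraph \<Rightarrow> bool" where
  "undirected_tree T \<longleftrightarrow> pair_graph T \<and> connected (with_proj T) \<and>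
     \<not> (\<exists>p. pre_digraph.cycle (with_proj T) p \<and> 3 \<le> length p)"

definition tree_decomposition ::
    "'a pair_pre_digraph \<Rightarrow> 't pair_pre_digraph \<Rightarrow> ('t \<Rightarrow> 'a set) \<Rightarrow> bool" where
  "tree_decomposition G T bag \<longleftrightarrow>
     undirected_tree T \<and>
     (\<forall>t \<in> pverts T. bag t \<subseteq> pverts G) \<and>
     (\<forall>v \<in> pverts G. \<exists>t \<in> pverts T. v \<in> bag t) \<and>
     (\<forall>(u, v) \<in> parcs G. \<exists>t \<in> pverts T. u \<in> bag t \<and> v \<in> bag t) \<and>
     (\<forall>v \<in> pverts G. connected (with_proj T \<restriction> {t \<in> pverts T. v \<in> bag t}))"

definition decomposition_width :: "'t pair_pre_digraph \<Rightarrow> ('t \<Rightarrow> 'a set) \<Rightarrow> nat" where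
  "decomposition_width T bag = Max ((\<lambda>t. card (bag t)) ` pverts T) - 1"

text \<open>
  Decomposition trees are finite, so it is no restriction that their nodes are natural numbers.
  For the empty graph this gives 0 instead of the customary \<open>-1\<close>.
\<close>

definition treewidth :: "'a pair_pre_digraph \<Rightarrow> nat" where
  "treewidth G = (LEAST w. \<exists>(T :: nat pair_pre_digraph) bag.
     tree_decomposition G T bag \<and> decomposition_width T bag = w)"

text \<open>The trivial decomposition shows that the minimum is over a nonempty set.\<close>

lemma tree_decomposition_trivial:
  fixes G :: "'a pair_pre_digraph"
  assumes "pair_graph G"
  shows "tree_decomposition G \<lparr>pverts = {0 :: nat}, parcs = {}\<rparr> (\<lambda>_. pverts G)"
proof -
  interpret G: pair_graph G by fact
  let ?T = "\<lparr>pverts = {0 :: nat}, parcs = {}\<rparr>"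
  have T: "pair_graph ?T"
    by unfold_locales (auto simp: symmetric_def)
  then interpret T: pair_graph ?T .
  have conn: "connected (with_proj ?T)"
    by (auto simp: connected_def strongly_connected_def mk_symmetric_def reachable_def
        intro: rtrancl_on_refl)
  have "with_proj ?T \<restriction> {0} = with_proj ?T"
    by (auto simp: induce_subgraph_def with_proj_def)
  then have ind: "connected (with_proj ?T \<restriction> {0})"
    using conn by metis
  have "\<not> pre_digraph.cycle (with_proj ?T) p" for p
    by (auto simp: pre_digraph.cycle_def pre_digraph.awalk_def)
  then show ?thesis
    using T conn ind G.in_arcsD1 G.in_arcsD2
    by (auto simp: tree_decomposition_def undirected_tree_def)
qed

section \<open>Shortest-path metric and coresets\<close>

text \<open>
  \<^const>\<open>wf_digraph.\<mu>\<close> with unit weights is the least number of edges of a walk. It is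
  finite on the vertices of a connected graph, the only case in which \<open>graph_dist\<close> is used.
\<close>

definition graph_dist :: "'a pair_pre_digraph \<Rightarrow> 'a \<Rightarrow> 'a \<Rightarrow> real" where
  "graph_dist G u v = real_of_ereal (wf_digraph.\<mu> (with_proj G) (\<lambda>_. 1) u v)"

text \<open>To be used for finite nonempty \<open>P \<subseteq> V\<close>, so that the maximum exists.\<close>

definition furthest_neighbor_coreset ::
    "'a set \<Rightarrow> ('a \<Rightarrow> 'a \<Rightarrow> real) \<Rightarrow> real \<Rightarrow> 'a set \<Rightarrow> 'a set \<Rightarrow> bool" where
  "furthest_neighbor_coreset V d \<epsilon> P Q \<longleftrightarrow>
     Q \<subseteq> P \<and> (\<forall>v \<in> V. \<exists>q \<in> Q. d v q \<ge> (1 - \<epsilon>) * (MAX p\<in>P. d v p))"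

end

theory Submission
  imports Defs "HOL-Library.Sublist"
begin

text \<open>
  Take two complete binary trees of height \<open>k\<close> whose nodes are the words of length at most \<open>k\<close>,
  join the roots by an edge, and join every node of the first tree at level \<open>j \<ge> 1\<close> to the sibling
  of its copy in the second tree by a path of length \<open>2j\<close>. Distinct leaf words split at some level,
  where the path leads over to the other tree, and the lengths are such that the two leaves are at
  distance at most \<open>2k\<close> whatever this level is; the two copies of the same leaf word are at distance
  \<open>2k + 1\<close>. Hence for \<open>\<epsilon> (2k + 1) < 1\<close> the set of all \<open>2\<^bsup>k+1\<^esup>\<close> leaves has no proper coreset.

  The graph is a subgraph of one obtained from copies of \<open>K\<^sub>3\<^sub>,\<^sub>3\<close> (a node and its two children,
  in both trees) and triangles by gluing along edges. Such gluings create neither a clique minor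
  on at least three vertices nor bags of size more than 6.
\<close>

section \<open>Connectedness by cuts\<close>

text \<open>Connectedness without walks: an arc leaves every proper nonempty part of
  \<open>B\<close>. To restrict a branch set or to add a vertex, one well-chosen cut is then
  enough.\<close>

definition cut_connected :: "'a rel \<Rightarrow> 'a set \<Rightarrow> bool" where
  "cut_connected E B \<longleftrightarrow> B \<noteq> {} \<and>
     (\<forall>S \<subseteq> B. S \<noteq> {} \<and> S \<noteq> B \<longrightarrow> (\<exists>u \<in> S. \<exists>v \<in> B - S. (u, v) \<in> E))"

lemma cut_connectedI:
  assumes "B \<noteq> {}"
    and "\<And>S. S \<subseteq> B \<Longrightarrow> S \<noteq> {} \<Longrightarrow> S \<noteq> B \<Longrightarrow> \<exists>u \<in> S. \<exists>v \<in> B - S. (u, v) \<in> E"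
  shows "cut_connected E B"
  using assms by (auto simp: cut_connected_def)

lemma cut_connectedE:
  assumes "cut_connected E B" "S \<subseteq> B" "S \<noteq> {}" "S \<noteq> B"
  obtains u v where "u \<in> S" "v \<in> B" "v \<notin> S" "(u, v) \<in> E"
  using assms unfolding cut_connected_def by blast

lemma cut_connected_nonempty: "cut_connected E B \<Longrightarrow> B \<noteq> {}"
  by (simp add: cut_connected_def)

lemma cut_connected_mono: "cut_connected E B \<Longrightarrow> E \<subseteq> F \<Longrightarrow> cut_connected F B"
  unfolding cut_connected_def by blast

lemma cut_connected_singleton: "cut_connected E {v}"
  by (rule cut_connectedI) (auto simp: subset_singleton_iff)

lemma rtrancl_leaves_set:
  assumes "(u, v) \<in> R\<^sup>*" "u \<in> S" "v \<notin> S"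
  shows "\<exists>x y. x \<in> S \<and> y \<notin> S \<and> (x, y) \<in> R"
  using assms by (induction rule: converse_rtrancl_induct) blast+

lemma cut_connected_if_rtrancl:
  assumes "sym E" "E \<subseteq> B \<times> B" "r \<in> B" "\<And>v. v \<in> B \<Longrightarrow> (v, r) \<in> E\<^sup>*"
  shows "cut_connected E B"
proof (rule cut_connectedI)
  fix S assume S: "S \<subseteq> B" "S \<noteq> {}" "S \<noteq> B"
  show "\<exists>u \<in> S. \<exists>v \<in> B - S. (u, v) \<in> E"
  proof (cases "r \<in> S")
    case True
    then obtain v where "v \<in> B" "v \<notin> S" using S by blast
    then have "\<exists>x y. x \<in> - S \<and> y \<notin> - S \<and> (x, y) \<in> E"
      using rtrancl_leaves_set[of v r E "- S"] assms(4) True by simp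
    then show ?thesis using assms(1,2) by (auto dest: symD)
  next
    case False
    then obtain v where "v \<in> S" using S by blast
    then have "\<exists>x y. x \<in> S \<and> y \<notin> S \<and> (x, y) \<in> E"
      using rtrancl_leaves_set[of v r E S] assms(4) False S by blast
    then show ?thesis using assms(2) by blast
  qed
qed (use assms in auto)

lemma cut_connected_insert:
  assumes "cut_connected E B" "t \<in> B" "(t, n) \<in> E" "(n, t) \<in> E"
  shows "cut_connected E (insert n B)"
proof (rule cut_connectedI)
  fix S assume S: "S \<subseteq> insert n B" "S \<noteq> {}" "S \<noteq> insert n B"
  show "\<exists>u \<in> S. \<exists>v \<in> insert n B - S. (u, v) \<in> E"
  proof (cases "B \<inter> S = {} \<or> B \<subseteq> S")
    case True
    then show ?thesis using S assms by blast
  next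
    case False
    then obtain u v where "u \<in> B \<inter> S" "v \<in> B" "v \<notin> B \<inter> S" "(u, v) \<in> E"
      using cut_connectedE[OF assms(1), of "B \<inter> S"] by blast
    then show ?thesis by blast
  qed
qed simp

text \<open>A walk from inside a cut to its outside contains a crossing arc; conversely, the set of
  vertices reachable from \<open>u\<close> is a cut that no arc leaves.\<close>

lemma connected_induce_iff_cut_connected:
  assumes "sym (parcs G)"
  shows "connected (with_proj G \<restriction> B) \<longleftrightarrow> cut_connected (parcs G) B"
proof -
  define F where "F = {(u, v) \<in> parcs G. u \<in> B \<and> v \<in> B}"
  have F: "parcs (mk_symmetric (with_proj G \<restriction> B)) = F"
    using assms by (auto simp: F_def mk_symmetric_def induce_subgraph_def dest: symD)
  have reach: "(u, v) \<in> rtrancl_on B F \<longleftrightarrow> (u, v) \<in> F\<^sup>*" if "u \<in> B" for u v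
  proof
    assume "(u, v) \<in> F\<^sup>*"
    then show "(u, v) \<in> rtrancl_on B F"
      by (induction rule: rtrancl_induct)
        (use that in \<open>auto simp: F_def intro: rtrancl_on_into_rtrancl_on\<close>)
  next
    assume "(u, v) \<in> rtrancl_on B F"
    then show "(u, v) \<in> F\<^sup>*"
      by (induction rule: rtrancl_on_induct) auto
  qed
  have conn: "connected (with_proj G \<restriction> B) \<longleftrightarrow> B \<noteq> {} \<and> (\<forall>u \<in> B. \<forall>v \<in> B. (u, v) \<in> F\<^sup>*)"
    by (auto simp: connected_def strongly_connected_def reachable_def F reach)
  show ?thesis
  proof
    assume L: "connected (with_proj G \<restriction> B)"
    show "cut_connected (parcs G) B"
    proof (rule cut_connectedI)
      fix S assume "S \<subseteq> B" "S \<noteq> {}" "S \<noteq> B"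
      then obtain u v where "u \<in> S" "v \<in> B" "v \<notin> S" "(u, v) \<in> F\<^sup>*" 
        using L unfolding conn by blast
      from rtrancl_leaves_set[OF this(4,1,3)]
      show "\<exists>u \<in> S. \<exists>v \<in> B - S. (u, v) \<in> parcs G" by (auto simp: F_def)
    qed (use L conn in auto)
  next
    assume R: "cut_connected (parcs G) B"
    have "(u, v) \<in> F\<^sup>*" if "u \<in> B" "v \<in> B" for u v
    proof (rule ccontr)
      assume "(u, v) \<notin> F\<^sup>*"
      define S where "S = {x \<in> B. (u, x) \<in> F\<^sup>*}"
      have "S \<subseteq> B" "S \<noteq> {}" "S \<noteq> B"
        using that \<open>(u, v) \<notin> F\<^sup>*\<close> by (auto simp: S_def)
      then obtain x y where "x \<in> S" "y \<in> B" "y \<notin> S" "(x, y) \<in> parcs G"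
        using cut_connectedE[OF R, of S] by blast
      then show False by (auto simp: S_def F_def intro: rtrancl.rtrancl_into_rtrancl)
    qed
    then show "connected (with_proj G \<restriction> B)"
      using R by (auto simp: conn cut_connected_def)
  qed
qed

lemma connected_iff_cut_connected:
  assumes "sym (parcs G)" "parcs G \<subseteq> pverts G \<times> pverts G"
  shows "connected (with_proj G) \<longleftrightarrow> cut_connected (parcs G) (pverts G)"
proof -
  have "with_proj G \<restriction> pverts G = with_proj G"
    using assms(2) by (auto simp: induce_subgraph_def with_proj_def)
  then show ?thesis using connected_induce_iff_cut_connected[OF assms(1), of "pverts G"] by simp
qed

lemma pair_graphI:
  assumes "finite V" "sym E" "irrefl E" "E \<subseteq> V \<times> V"
  shows "pair_graph \<lparr>pverts = V, parcs = E\<rparr>"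
proof -
  have "finite E" using assms by (meson finite_SigmaI finite_subset)
  then show ?thesis
    using assms by unfold_locales (auto simp: symmetric_def irrefl_def)
qed

lemma pair_graphD:
  assumes "pair_graph G"
  shows "finite (pverts G)" "sym (parcs G)" "irrefl (parcs G)" "parcs G \<subseteq> pverts G \<times> pverts G"
proof -
  interpret pair_graph G by fact
  show "finite (pverts G)" "sym (parcs G)" "irrefl (parcs G)" "parcs G \<subseteq> pverts G \<times> pverts G"
    using sym_arcs pair_no_loops in_arcsD1 in_arcsD2
    by (auto simp: symmetric_def irrefl_def) force
qed

section \<open>Clique minors and edge sums\<close>

text \<open>A complete minor with branch sets indexed by \<open>I\<close>. Bare vertex and arc sets
  replace graph records, so that gluing is a union and restriction an intersection.\<close>

definition clique_model :: "'i set \<Rightarrow> 'a set \<Rightarrow> 'a rel \<Rightarrow> ('i \<Rightarrow> 'a set) \<Rightarrow> bool" where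
  "clique_model I V E B \<longleftrightarrow>
     (\<forall>i \<in> I. B i \<subseteq> V \<and> cut_connected E (B i)) \<and>
     (\<forall>i \<in> I. \<forall>j \<in> I. i \<noteq> j \<longrightarrow> B i \<inter> B j = {} \<and> (\<exists>u \<in> B i. \<exists>v \<in> B j. (u, v) \<in> E))"

lemma clique_model_mono: "clique_model I V E B \<Longrightarrow> V \<subseteq> W \<Longrightarrow> E \<subseteq> F \<Longrightarrow> clique_model I W F B"
  unfolding clique_model_def by (meson cut_connected_mono order_trans subsetD)

lemma complete_minor_free_if_no_clique_model:
  assumes "sym E" "\<And>(I :: nat set) B. finite I \<Longrightarrow> card I = n \<Longrightarrow> \<not> clique_model I V E B"
  shows "complete_minor_free n \<lparr>pverts = V, parcs = E\<rparr>"
proof -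
  let ?G = "\<lparr>pverts = V, parcs = E\<rparr>"
  have False if H: "K\<^bsub>n\<^esub> (with_proj H)" "is_minor H ?G" for H :: "nat pair_pre_digraph"
  proof -
    have H': "finite (pverts H)" "card (pverts H) = n"
      "parcs H = {(u, v). u \<in> pverts H \<and> v \<in> pverts H \<and> u \<noteq> v}"
      using H(1) by (auto simp: complete_digraph_pair_def)
    have conn: "connected (with_proj ?G \<restriction> S) \<longleftrightarrow> cut_connected E S" for S
      using connected_induce_iff_cut_connected[of ?G S] assms(1) by simp
    obtain B where B: "\<forall>x \<in> pverts H. B x \<subseteq> V \<and> cut_connected E (B x)"
      "\<forall>x \<in> pverts H. \<forall>y \<in> pverts H. x \<noteq> y \<longrightarrow> B x \<inter> B y = {}"
      "\<forall>(x, y) \<in> parcs H. \<exists>u \<in> B x. \<exists>v \<in> B y. (u, v) \<in> E"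
      using H(2) unfolding is_minor_def conn by auto
    from B(3) have "\<exists>u \<in> B x. \<exists>v \<in> B y. (u, v) \<in> E" if "x \<in> pverts H" "y \<in> pverts H" "x \<noteq> y" for x y
      using that by (simp add: H'(3))
    then have "clique_model (pverts H) V E B" using B(1,2) by (simp add: clique_model_def)
    then show False using assms(2) H' by blast
  qed
  then show ?thesis by (auto simp: complete_minor_free_def)
qed

text \<open>The edge \<open>(a, b)\<close> takes over the connections of \<open>B\<close> that run outside of \<open>W\<close>.\<close>

lemma cut_connected_restrict_edge_separation:
  assumes B: "cut_connected E B" "B \<inter> W \<noteq> {}"
    and E: "sym E" "(a, b) \<in> E"
    and sep: "\<And>u v. (u, v) \<in> E \<Longrightarrow> u \<in> W \<Longrightarrow> v \<notin> W \<Longrightarrow> u \<in> {a, b}"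
  shows "cut_connected (E \<inter> W \<times> W) (B \<inter> W)"
proof (rule cut_connectedI)
  fix S assume S: "S \<subseteq> B \<inter> W" "S \<noteq> {}" "S \<noteq> B \<inter> W"
  show "\<exists>u \<in> S. \<exists>v \<in> B \<inter> W - S. (u, v) \<in> E \<inter> W \<times> W"
  proof (rule ccontr)
    assume no: "\<not> ?thesis"
    then have no': "(u, v) \<notin> E" if "u \<in> S" "v \<in> B \<inter> W - S" for u v
      using that S by blast
    have ab: "\<not> (a \<in> S \<and> b \<in> B \<inter> W - S)" "\<not> (b \<in> S \<and> a \<in> B \<inter> W - S)"
      using no' E by (auto dest: symD)
    \<comment> \<open>\<open>T\<close> is a cut of \<open>B\<close> that no arc leaves. If
      \<open>S\<close> avoids \<open>a\<close> and \<open>b\<close>, no arc leads from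
      \<open>S\<close> out of \<open>W\<close>. Otherwise the part of \<open>B\<close> outside
      \<open>W\<close> is added: an arc from there into \<open>W\<close> ends in \<open>a\<close> or
      \<open>b\<close>, and since one of them is in \<open>S\<close>, the edge between them forbids
      the other in \<open>B \<inter> W - S\<close>.\<close>
    define T where "T = (if S \<inter> {a, b} = {} then S else S \<union> (B - W))"
    have "T \<subseteq> B" "T \<noteq> {}" "T \<noteq> B" using S by (auto simp: T_def split: if_splits)
    then obtain u v where uv: "u \<in> T" "v \<in> B" "v \<notin> T" "(u, v) \<in> E"
      using cut_connectedE[OF B(1), of T] by blast
    have vu: "(v, u) \<in> E" using uv E by (auto dest: symD)
    show False
    proof (cases "S \<inter> {a, b} = {}")
      case True
      then have "u \<in> S" "v \<in> B - W" using uv S no' by (auto simp: T_def)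
      then show False using sep[OF uv(4)] True S by auto
    next
      case False
      then have "u \<in> S \<union> (B - W)" "v \<in> B \<inter> W - S" using uv by (auto simp: T_def)
      moreover from this have "u \<notin> W" using no' uv S by blast
      ultimately have "v \<in> {a, b}" using sep[OF vu] by auto
      then show False using ab False \<open>v \<in> B \<inter> W - S\<close> by auto
    qed
  qed
qed (use B in auto)

text \<open>Branch set \<open>i\<close> lies in \<open>W\<close> away from \<open>a\<close> and
  \<open>b\<close>, so all its neighbours meet \<open>W\<close>. A branch set leaving
  \<open>W\<close> contains \<open>a\<close> or \<open>b\<close>; hence an adjacency realised only
  by an arc not inside \<open>W\<close> can use the edge between \<open>a\<close> and
  \<open>b\<close> instead.\<close>

lemma clique_model_restrict_edge_separation:
  assumes B: "clique_model I V E B"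
    and E: "sym E" "(a, b) \<in> E" "a \<in> W" "b \<in> W"
    and sep: "\<And>u v. (u, v) \<in> E \<Longrightarrow> u \<in> W \<Longrightarrow> v \<notin> W \<Longrightarrow> u \<in> {a, b}"
    and i: "i \<in> I" "B i \<subseteq> W - {a, b}"
  shows "clique_model I W (E \<inter> W \<times> W) (\<lambda>j. B j \<inter> W)"
proof -
  have conn: "cut_connected E (B j)" if "j \<in> I" for j
    using B that by (auto simp: clique_model_def)
  have adj: "\<exists>u \<in> B j. \<exists>v \<in> B l. (u, v) \<in> E" and disj: "B j \<inter> B l = {}"
    if "j \<in> I" "l \<in> I" "j \<noteq> l" for j l
    using B that by (auto simp: clique_model_def)
  have meets: "B j \<inter> W \<noteq> {}" if "j \<in> I" for j
  proof (cases "j = i")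
    case True
    then show ?thesis using cut_connected_nonempty[OF conn[OF that]] i by auto
  next
    case False
    then obtain u v where uv: "u \<in> B i" "v \<in> B j" "(u, v) \<in> E"
      using adj[OF i(1) \<open>j \<in> I\<close>] by blast
    then have "v \<in> W" using sep[OF uv(3)] i by blast
    then show ?thesis using uv by blast
  qed
  have contains: "B j \<inter> {a, b} \<noteq> {}" if j: "j \<in> I" and "\<not> B j \<subseteq> W" for j
  proof -
    have "B j \<inter> W \<noteq> B j" using that by blast
    then obtain u v where uv: "u \<in> B j \<inter> W" "v \<in> B j" "v \<notin> B j \<inter> W" "(u, v) \<in> E"
      using cut_connectedE[OF conn[OF j] Int_lower1 meets[OF j]] by metis
    then show ?thesis using sep[OF uv(4)] by blast
  qed
  have "\<exists>u \<in> B j \<inter> W. \<exists>v \<in> B l \<inter> W. (u, v) \<in> E \<inter> W \<times> W"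
    if jl: "j \<in> I" "l \<in> I" "j \<noteq> l" for j l
  proof -
    obtain u v where uv: "u \<in> B j" "v \<in> B l" "(u, v) \<in> E" using adj jl by blast
    have vu: "(v, u) \<in> E" using uv E by (auto dest: symD)
    show ?thesis
    proof (cases "u \<in> W \<and> v \<in> W")
      case True
      then show ?thesis using uv by blast
    next
      case False
      have "B j \<inter> {a, b} \<noteq> {}"
        using False uv contains[OF jl(1)] sep[OF uv(3)] by blast
      moreover have "B l \<inter> {a, b} \<noteq> {}"
        using False uv contains[OF jl(2)] sep[OF vu] by blast
      ultimately have "a \<in> B j \<and> b \<in> B l \<or> b \<in> B j \<and> a \<in> B l"
        using disj[OF jl] by blast
      then show ?thesis using E by (auto dest: symD)
    qed
  qed
  moreover have "cut_connected (E \<inter> W \<times> W) (B j \<inter> W)" if "j \<in> I" for j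
    by (rule cut_connected_restrict_edge_separation[OF conn[OF that] meets[OF that] E(1,2) sep])
  moreover have "(B j \<inter> W) \<inter> (B l \<inter> W) = {}" if "j \<in> I" "l \<in> I" "j \<noteq> l" for j l
    using disj[OF that] by blast
  ultimately show ?thesis unfolding clique_model_def by (meson Int_lower2)
qed

text \<open>Among three disjoint branch sets one avoids both ends of the common edge. Being
  connected, it lies on one side, and the whole model restricts to that side.\<close>

lemma no_clique_model_edge_sum:
  assumes G: "sym E" "irrefl E" "E \<subseteq> V \<times> V" "(a, b) \<in> E"
    and H: "sym F" "irrefl F" "F \<subseteq> X \<times> X" "(a, b) \<in> F"
    and VX: "V \<inter> X = {a, b}"
    and I: "3 \<le> card I"
    and no: "\<And>B. \<not> clique_model I V E B" "\<And>B. \<not> clique_model I X F B"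
  shows "\<not> clique_model I (V \<union> X) (E \<union> F) B"
proof
  assume B: "clique_model I (V \<union> X) (E \<union> F) B"
  have EF: "sym (E \<union> F)" "(a, b) \<in> E \<union> F" using G H by (auto simp: sym_Un)
  have ba: "(b, a) \<in> E" "(b, a) \<in> F" using G H by (auto dest: symD)
  \<comment> \<open>The sides share only \<open>a\<close> and \<open>b\<close> and there are no
    loops, so only the common edge lies on both sides.\<close>
  have restrict: "(E \<union> F) \<inter> V \<times> V = E" "(E \<union> F) \<inter> X \<times> X = F"
  proof -
    have ab: "(u, v) \<in> {(a, b), (b, a)}" if "u \<in> V \<inter> X" "v \<in> V \<inter> X" "u \<noteq> v" for u v
      using that unfolding VX by blast
    have "F \<inter> V \<times> V \<subseteq> {(a, b), (b, a)}"
    proof (intro subrelI)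
      fix u v assume "(u, v) \<in> F \<inter> V \<times> V"
      then show "(u, v) \<in> {(a, b), (b, a)}" using ab[of u v] H(2,3) by (auto simp: irrefl_def)
    qed
    then show "(E \<union> F) \<inter> V \<times> V = E" using G(3,4) ba(1) by blast
    have "E \<inter> X \<times> X \<subseteq> {(a, b), (b, a)}"
    proof (intro subrelI)
      fix u v assume "(u, v) \<in> E \<inter> X \<times> X"
      then show "(u, v) \<in> {(a, b), (b, a)}" using ab[of u v] G(2,3) by (auto simp: irrefl_def)
    qed
    then show "(E \<union> F) \<inter> X \<times> X = F" using H(3,4) ba(2) by blast
  qed
  have sepV: "u \<in> {a, b}" if "(u, v) \<in> E \<union> F" "u \<in> V" "v \<notin> V" for u v
    using that G(3) H(3) VX by blast
  have sepX: "u \<in> {a, b}" if "(u, v) \<in> E \<union> F" "u \<in> X" "v \<notin> X" for u v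
    using that G(3) H(3) VX by blast
  have "\<exists>i \<in> I. B i \<inter> {a, b} = {}"
  proof (rule ccontr)
    assume all: "\<not> ?thesis"
    obtain J where "J \<subseteq> I" "card J = 3"
      using obtain_subset_with_card_n[OF I] by blast
    then obtain i j l where ijl: "i \<in> I" "j \<in> I" "l \<in> I" "i \<noteq> j" "j \<noteq> l" "i \<noteq> l"
      by (auto simp: card_3_iff)
    have "B i \<inter> B j = {}" "B j \<inter> B l = {}" "B i \<inter> B l = {}"
      using B ijl by (auto simp: clique_model_def)
    moreover have "B i \<inter> {a, b} \<noteq> {}" "B j \<inter> {a, b} \<noteq> {}" "B l \<inter> {a, b} \<noteq> {}"
      using all ijl by blast+
    ultimately show False by blast
  qed
  then obtain i where i: "i \<in> I" "B i \<inter> {a, b} = {}" by blast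
  have Bi: "B i \<subseteq> V \<union> X" "cut_connected (E \<union> F) (B i)"
    using B i by (auto simp: clique_model_def)
  have "B i \<subseteq> V \<or> B i \<subseteq> X"
  proof (rule ccontr)
    assume "\<not> ?thesis"
    then have "B i \<inter> V \<noteq> {}" "B i \<inter> V \<noteq> B i" using Bi by auto
    then obtain u v where "u \<in> B i \<inter> V" "v \<in> B i" "v \<notin> B i \<inter> V" "(u, v) \<in> E \<union> F"
      using cut_connectedE[OF Bi(2), of "B i \<inter> V"] by blast
    then show False using sepV i by blast
  qed
  then consider "B i \<subseteq> V - {a, b}" | "B i \<subseteq> X - {a, b}" using i by blast
  then show False
  proof cases
    case 1
    have "clique_model I V ((E \<union> F) \<inter> V \<times> V) (\<lambda>j. B j \<inter> V)"
      by (rule clique_model_restrict_edge_separation[OF B EF _ _ _ i(1) 1])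
        (use VX in blast, use VX in blast, rule sepV)
    then show False using no(1) by (simp add: restrict)
  next
    case 2
    have "clique_model I X ((E \<union> F) \<inter> X \<times> X) (\<lambda>j. B j \<inter> X)"
      by (rule clique_model_restrict_edge_separation[OF B EF _ _ _ i(1) 2])
        (use VX in blast, use VX in blast, rule sepX)
    then show False using no(2) by (simp add: restrict)
  qed
qed

section \<open>Graphs without clique models by size or colouring\<close>

lemma no_clique_model_card_less:
  assumes "finite X" "finite I" "card X < card I"
  shows "\<not> clique_model I X F B"
proof
  assume B: "clique_model I X F B"
  define f where "f i = (SOME x. x \<in> B i)" for i
  have f: "f i \<in> B i" if "i \<in> I" for i
    using B that cut_connected_nonempty[of F "B i"]
    by (auto simp: f_def clique_model_def some_in_eq)
  have "inj_on f I"
  proof (rule inj_onI, rule ccontr)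
    fix i j assume ij: "i \<in> I" "j \<in> I" "f i = f j" "i \<noteq> j"
    then have "B i \<inter> B j = {}" using B by (simp add: clique_model_def)
    then show False using f[of i] f[of j] ij by auto
  qed
  moreover have "f ` I \<subseteq> X" using f B by (auto simp: clique_model_def)
  ultimately show False using card_inj_on_le[of f I X] assms by simp
qed

text \<open>At least four of the branch sets are singletons, and two of these have the same colour.\<close>

lemma no_clique_model_bipartite:
  assumes "finite X" "card X \<le> 6" "finite I" "card I = 5"
    and colouring: "\<And>u v. (u, v) \<in> F \<Longrightarrow> c u \<noteq> (c v :: bool)"
  shows "\<not> clique_model I X F B"
proof
  assume B: "clique_model I X F B"
  have fin: "finite (B i)" and ne: "B i \<noteq> {}" if "i \<in> I" for i
    using B that finite_subset[OF _ assms(1)] cut_connected_nonempty[of F "B i"]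
    by (auto simp: clique_model_def)
  define J where "J = {i \<in> I. card (B i) = 1}"
  \<comment> \<open>Every branch set has a vertex and those outside \<open>J\<close> have at least
    two. They are disjoint in at most 6 vertices, so at most 6 - 5 = 1 of them is outside
    \<open>J\<close>.\<close>
  have "card I + card (I - J) = (\<Sum>i \<in> I. 1 + (if i \<in> J then 0 else 1))"
    using assms(3) by (simp only: sum.distrib) (simp add: sum.If_cases Diff_eq)
  also have "\<dots> \<le> (\<Sum>i \<in> I. card (B i))"
  proof (rule sum_mono)
    fix i assume "i \<in> I"
    then have "card (B i) \<noteq> 0" using fin ne by simp
    then show "1 + (if i \<in> J then 0 else 1) \<le> card (B i)"
      using \<open>i \<in> I\<close> by (auto simp: J_def)
  qed
  also have "\<dots> = card (\<Union>i \<in> I. B i)"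
    using B assms(3) fin by (subst card_UN_disjoint) (auto simp: clique_model_def)
  also have "\<dots> \<le> card X"
    using B assms(1) by (intro card_mono) (auto simp: clique_model_def)
  finally have "card (I - J) \<le> 1" using assms by simp
  moreover have "card (I - J) = card I - card J"
    using assms(3) by (intro card_Diff_subset) (auto simp: J_def)
  ultimately have J: "3 \<le> card J" using assms by simp
  obtain K where "K \<subseteq> J" "card K = 3"
    using obtain_subset_with_card_n[OF J] by blast
  then obtain i j l where ijl: "i \<in> J" "j \<in> J" "l \<in> J" "i \<noteq> j" "j \<noteq> l" "i \<noteq> l"
    by (auto simp: card_3_iff)
  have "\<exists>x. B m = {x}" if "m \<in> J" for m
    using that by (simp add: J_def card_1_singleton_iff)
  then obtain x y z where xyz: "B i = {x}" "B j = {y}" "B l = {z}"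
    using ijl by meson
  have "i \<in> I" "j \<in> I" "l \<in> I" using ijl by (auto simp: J_def)
  then have "\<exists>u \<in> B i. \<exists>v \<in> B j. (u, v) \<in> F" "\<exists>u \<in> B j. \<exists>v \<in> B l. (u, v) \<in> F"
    "\<exists>u \<in> B i. \<exists>v \<in> B l. (u, v) \<in> F"
    using B ijl by (simp_all add: clique_model_def)
  then have "(x, y) \<in> F" "(y, z) \<in> F" "(x, z) \<in> F"
    by (auto simp: xyz)
  then show False using colouring by blast
qed

section \<open>Tree decompositions\<close>

lemma pcas_append: "pcas u (p @ q) v \<longleftrightarrow> (\<exists>w. pcas u p w \<and> pcas w q v)"
  by (induction p arbitrary: u) auto

text \<open>A cycle of length at least 3 either avoids \<open>n\<close> and lies in
  \<open>T\<close>, or enters \<open>n\<close> from \<open>t\<close> and must go straight back,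
  visiting \<open>t\<close> twice.\<close>

lemma undirected_tree_add_leaf:
  assumes T: "undirected_tree T" and t: "t \<in> pverts T" and n: "n \<notin> pverts T"
  shows "undirected_tree \<lparr>pverts = insert n (pverts T), parcs = parcs T \<union> {(t, n), (n, t)}\<rparr>"
    (is "undirected_tree ?T'")
proof -
  have "pair_graph T" using T by (simp add: undirected_tree_def)
  note PT = pair_graphD[OF this]
  have sym': "sym (parcs ?T')" using PT(2) by (auto simp: sym_def)
  have "pair_graph ?T'"
    using PT t n sym' by (intro pair_graphI) (auto simp: irrefl_def)
  moreover have "connected (with_proj ?T')"
  proof -
    have "cut_connected (parcs T) (pverts T)"
      using T connected_iff_cut_connected[OF PT(2,4)] by (simp add: undirected_tree_def)
    then have "cut_connected (parcs ?T') (pverts T)" by (rule cut_connected_mono) auto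
    then have "cut_connected (parcs ?T') (pverts ?T')"
      using cut_connected_insert[of "parcs ?T'" "pverts T" t n] t by simp
    then show ?thesis
      by (subst connected_iff_cut_connected[OF sym']) (use PT t in auto)
  qed
  moreover have False if cyc: "pre_digraph.cycle (with_proj ?T') p" and len: "3 \<le> length p" for p
  proof -
    obtain u where u: "u \<in> pverts ?T'" "set p \<subseteq> parcs ?T'" "pcas u p u"
      "distinct (tl (pawalk_verts u p))"
      using cyc by (auto simp: pre_digraph.cycle_def pre_digraph.awalk_def cas_with_proj_eq
          awalk_verts_with_proj_eq)
    \<comment> \<open>The vertices after the start are the heads of the arcs, and distinctness of
      the heads survives a rotation of the cycle.\<close>
    have heads: "pawalk_verts x q = x # map snd q" if "pcas x q y" for x y q
      using that by (induction q arbitrary: x) auto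
    have last: "snd (last q) = y" if "pcas x q y" "q \<noteq> []" for x y q
      using that by (induction q arbitrary: x) auto
    have dist: "distinct (map snd p)" using u(4) heads[OF u(3)] by simp
    have last_p: "u \<in> snd ` set p" using last[OF u(3)] len last_in_set[of p] by fastforce
    show False
    proof (cases "n \<in> snd ` set p")
      case False
      have "e \<in> parcs T" if e: "e \<in> set p" for e
      proof (rule ccontr)
        assume "e \<notin> parcs T"
        \<comment> \<open>The tail \<open>n\<close> of this arc is the head of the preceding arc or,
          if the arc comes first, of the last one.\<close>
        then have "e = (n, t)" using u(2) e False by force
        then obtain q r where p: "p = q @ (n, t) # r" using e by (auto simp: in_set_conv_decomp)
        then have q: "pcas u q n" using u(3) by (auto simp: pcas_append)
        show False
        proof (cases "q = []")
          case True
          then show False using q last_p False by simp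
        next
          case ne: False
          then have "n \<in> snd ` set q" using last[OF q ne] last_in_set[OF ne] by force
          then show False using False p by (auto simp: image_Un)
        qed
      qed
      moreover have "u \<in> pverts T" using u(1) last_p False by auto
      ultimately have "pre_digraph.cycle (with_proj T) p"
        using u(3,4) len by (auto simp: pre_digraph.cycle_def pre_digraph.awalk_def
            cas_with_proj_eq awalk_verts_with_proj_eq)
      then show False using T len by (auto simp: undirected_tree_def)
    next
      case True
      then obtain e where "e \<in> set p" "snd e = n" by auto
      moreover from this have "e \<in> parcs ?T'" "e \<notin> parcs T" using u(2) n PT(4) by auto
      then have "e = (t, n)" using \<open>snd e = n\<close> t n by (auto simp: prod_eq_iff)
      ultimately obtain q r where p: "p = q @ (t, n) # r"
        by (auto simp: in_set_conv_decomp)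
      \<comment> \<open>The cycle is rotated past \<open>(t, n)\<close>. The rest starts at
        \<open>n\<close>, so its first arc is \<open>(n, t)\<close>; it ends in \<open>t\<close>, so
        its last arc, a different one, has the same head.\<close>
      then have "pcas n (r @ q) t" using u(3) by (auto simp: pcas_append)
      moreover have "2 \<le> length (r @ q)" using p len by simp
      moreover from this obtain e s where s: "r @ q = e # s" "s \<noteq> []"
        by (metis One_nat_def Suc_1 Suc_le_length_iff list.distinct(1))
      ultimately have es: "fst e = n" "pcas (snd e) s t" by simp_all
      have "set (r @ q) \<subseteq> parcs ?T'" using u(2) p by auto
      then have "e \<in> parcs ?T'" using s(1) by auto
      then have "snd e = t" using es(1) n PT(4) t by (auto simp: prod_eq_iff)
      moreover have "distinct (map snd (r @ q))" using dist p by auto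
      then have "distinct (map snd (e # s))" using s(1) by simp
      then have "snd e \<noteq> snd (last s)" using last_in_set[OF s(2)] by auto
      ultimately show False using last[OF es(2) s(2)] by simp
    qed
  qed
  ultimately show ?thesis unfolding undirected_tree_def by blast
qed


text \<open>The nodes of a vertex of \<open>X\<close> stay connected: either the vertex is new and
  occurs only at \<open>n\<close>, or it is in \<open>V \<inter> X\<close> and hence in the bag of
  the neighbour \<open>t\<close>.\<close>

lemma tree_decomposition_add_leaf:
  assumes T: "tree_decomposition \<lparr>pverts = V, parcs = E\<rparr> T bag"
    and t: "t \<in> pverts T" "V \<inter> X \<subseteq> bag t" and n: "n \<notin> pverts T"
    and F: "F \<subseteq> X \<times> X"
  shows "tree_decomposition \<lparr>pverts = V \<union> X, parcs = E \<union> F\<rparr>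
    \<lparr>pverts = insert n (pverts T), parcs = parcs T \<union> {(t, n), (n, t)}\<rparr> (bag(n := X))"
    (is "tree_decomposition ?G ?T ?bag")
proof -
  have tree: "undirected_tree T" using T by (simp add: tree_decomposition_def)
  then have tree': "undirected_tree ?T" using undirected_tree_add_leaf[OF _ t(1) n] by blast
  have sym: "sym (parcs T)" "sym (parcs ?T)"
    using pair_graphD(2)[of T] pair_graphD(2)[of ?T] tree tree' unfolding undirected_tree_def
    by blast+
  have bag: "bag s \<subseteq> V" if "s \<in> pverts T" for s
    using T that by (auto simp: tree_decomposition_def)
  have conn: "cut_connected (parcs T) {s \<in> pverts T. v \<in> bag s}" if "v \<in> V" for v
    using T that by (auto simp: tree_decomposition_def connected_induce_iff_cut_connected[OF sym(1)])
  have conn': "cut_connected (parcs ?T) {s \<in> pverts ?T. v \<in> ?bag s}" if v: "v \<in> V \<union> X" for v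
  proof -
    let ?S = "{s \<in> pverts T. v \<in> bag s}"
    have S: "{s \<in> pverts ?T. v \<in> ?bag s} = (if v \<in> X then insert n ?S else ?S)"
      using n by auto
    show ?thesis
    proof (cases "v \<in> V")
      case True
      have "cut_connected (parcs ?T) ?S"
        using conn[OF True] by (rule cut_connected_mono) auto
      moreover have "cut_connected (parcs ?T) (insert n ?S)" if "v \<in> X"
        using cut_connected_insert[OF calculation, of t n] that True t by auto
      ultimately show ?thesis by (simp only: S split: if_split) blast
    next
      case False
      then have "?S = {}" "v \<in> X" using bag v by auto
      then show ?thesis by (simp only: S) (simp add: cut_connected_singleton)
    qed
  qed
  have ins: "(\<exists>s \<in> pverts ?T. Q (?bag s)) \<longleftrightarrow> Q X \<or> (\<exists>s \<in> pverts T. Q (bag s))" for Q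
    using n by (auto simp: fun_upd_def)
  have "\<forall>(u, v) \<in> parcs ?G. \<exists>s \<in> pverts ?T. u \<in> ?bag s \<and> v \<in> ?bag s"
    using T F unfolding ins[of "\<lambda>Y. _ \<in> Y \<and> _ \<in> Y"] tree_decomposition_def by auto
  moreover have "\<forall>v \<in> pverts ?G. \<exists>s \<in> pverts ?T. v \<in> ?bag s"
    using T unfolding ins[of "\<lambda>Y. _ \<in> Y"] tree_decomposition_def by auto
  moreover have "\<forall>v \<in> pverts ?G. connected (with_proj ?T \<restriction> {s \<in> pverts ?T. v \<in> ?bag s})"
    unfolding connected_induce_iff_cut_connected[OF sym(2)] using conn' by simp
  moreover have "\<forall>s \<in> pverts ?T. ?bag s \<subseteq> pverts ?G" using bag by auto
  ultimately show ?thesis using tree' unfolding tree_decomposition_def by blast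
qed

lemma treewidth_le:
  fixes T :: "nat pair_pre_digraph"
  assumes "tree_decomposition G T bag" "\<And>t. t \<in> pverts T \<Longrightarrow> card (bag t) \<le> Suc w"
  shows "treewidth G \<le> w"
proof -
  have T: "pair_graph T" "connected (with_proj T)"
    using assms(1) by (auto simp: tree_decomposition_def undirected_tree_def)
  have "pverts T \<noteq> {}" "finite (pverts T)"
    using T pair_graphD[OF T(1)] connected_iff_cut_connected cut_connected_nonempty by blast+
  then have "decomposition_width T bag \<le> w"
    using assms(2) by (simp add: decomposition_width_def le_diff_conv)
  moreover have "treewidth G \<le> decomposition_width T bag"
    unfolding treewidth_def using assms(1) by (intro Least_le) blast
  ultimately show ?thesis by simp
qed

section \<open>Edge sums of small pieces\<close>

text \<open>Six is the bag size for treewidth 5, and five branch sets make a K_5. The pieces used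
  are a single edge, triangles and K_{3,3}.\<close>

definition piece :: "'a set \<Rightarrow> 'a rel \<Rightarrow> bool" where
  "piece X F \<longleftrightarrow> finite X \<and> card X \<le> 6 \<and> sym F \<and> irrefl F \<and> F \<subseteq> X \<times> X \<and>
     (\<forall>(I :: nat set) B. card I = 5 \<longrightarrow> \<not> clique_model I X F B)"

lemma piece_card_less:
  assumes "finite X" "card X < 5" "sym F" "irrefl F" "F \<subseteq> X \<times> X"
  shows "piece X F"
proof -
  have "\<not> clique_model I X F B" if "card I = 5" for I :: "nat set" and B
    using that assms(1,2) by (intro no_clique_model_card_less) (auto simp: card_ge_0_finite)
  then show ?thesis using assms by (simp add: piece_def)
qed

text \<open>A clique sum along an edge that is kept, so that it stays available for further
  gluing.\<close>

inductive edge_sum :: "'a set \<Rightarrow> 'a rel \<Rightarrow> bool" where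
  base: "piece X F \<Longrightarrow> edge_sum X F"
| step: "edge_sum V E \<Longrightarrow> piece X F \<Longrightarrow> (a, b) \<in> E \<Longrightarrow> (a, b) \<in> F \<Longrightarrow> V \<inter> X = {a, b} \<Longrightarrow>
    edge_sum (V \<union> X) (E \<union> F)"

lemma edge_sum_graph:
  assumes "edge_sum V E"
  shows "finite V" "sym E" "irrefl E" "E \<subseteq> V \<times> V"
  using assms by induction (auto simp: piece_def sym_Un irrefl_def)

lemma edge_sum_no_clique_model:
  assumes "edge_sum V E" "card (I :: nat set) = 5"
  shows "\<not> clique_model I V E B"
  using assms
proof (induction arbitrary: B)
  case (base X F)
  then show ?case by (auto simp: piece_def)
next
  case (step V E X F a b)
  note E = edge_sum_graph[OF step.hyps(1)]
  have F: "sym F" "irrefl F" "F \<subseteq> X \<times> X" "\<not> clique_model I X F B" for B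
    using step.hyps(2) step.prems by (auto simp: piece_def)
  have I: "3 \<le> card I" using step.prems by simp
  show ?case
    by (rule no_clique_model_edge_sum[OF E(2-4) step.hyps(3) F(1-3) step.hyps(4,5) I
          step.IH[OF step.prems] F(4)])
qed

text \<open>Each piece is a bag. The common edge lies in some bag, and the new piece is attached
  there as a leaf.\<close>

lemma edge_sum_tree_decomposition:
  assumes "edge_sum V E"
  shows "\<exists>(T :: nat pair_pre_digraph) bag.
    tree_decomposition \<lparr>pverts = V, parcs = E\<rparr> T bag \<and> (\<forall>t \<in> pverts T. card (bag t) \<le> 6)"
  using assms
proof induction
  case (base X F)
  then have "pair_graph \<lparr>pverts = X, parcs = F\<rparr>"
    by (intro pair_graphI) (auto simp: piece_def)
  then have "tree_decomposition \<lparr>pverts = X, parcs = F\<rparr> \<lparr>pverts = {0 :: nat}, parcs = {}\<rparr> (\<lambda>_. X)"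
    using tree_decomposition_trivial[of "\<lparr>pverts = X, parcs = F\<rparr>"] by simp
  moreover have "card X \<le> 6" using base by (simp add: piece_def)
  ultimately show ?case by (intro exI conjI ballI)
next
  case (step V E X F a b)
  then obtain T :: "nat pair_pre_digraph" and bag
    where T: "tree_decomposition \<lparr>pverts = V, parcs = E\<rparr> T bag" "\<forall>t \<in> pverts T. card (bag t) \<le> 6"
    by blast
  have "pair_graph T" using T by (simp add: tree_decomposition_def undirected_tree_def)
  then obtain n where n: "n \<notin> pverts T" using pair_graphD(1) ex_new_if_finite infinite_UNIV_nat by blast
  obtain t where t: "t \<in> pverts T" "V \<inter> X \<subseteq> bag t"
    using T(1) step.hyps by (fastforce simp: tree_decomposition_def)
  have "F \<subseteq> X \<times> X" "card X \<le> 6" using step.hyps by (auto simp: piece_def)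
  have "\<forall>s \<in> pverts \<lparr>pverts = insert n (pverts T), parcs = parcs T \<union> {(t, n), (n, t)}\<rparr>.
      card ((bag(n := X)) s) \<le> 6"
    using T(2) \<open>card X \<le> 6\<close> by simp
  with tree_decomposition_add_leaf[OF T(1) t n \<open>F \<subseteq> X \<times> X\<close>] show ?case by blast
qed

text \<open>This removes the edges that serve only for gluing: clique models pass from the subgraph
  to the sum, tree decompositions from the sum to the subgraph.\<close>

lemma subgraph_edge_sum:
  assumes "edge_sum V E" "E' \<subseteq> E" "sym E'"
  shows "complete_minor_free 5 \<lparr>pverts = V, parcs = E'\<rparr>"
    and "treewidth \<lparr>pverts = V, parcs = E'\<rparr> \<le> 5"
proof -
  show "complete_minor_free 5 \<lparr>pverts = V, parcs = E'\<rparr>"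
  proof (rule complete_minor_free_if_no_clique_model[OF assms(3)])
    fix I :: "nat set" and B assume "card I = 5"
    then show "\<not> clique_model I V E' B"
      using edge_sum_no_clique_model[OF assms(1)] clique_model_mono[OF _ order_refl assms(2)] by metis
  qed
  obtain T :: "nat pair_pre_digraph" and bag
    where "tree_decomposition \<lparr>pverts = V, parcs = E\<rparr> T bag" "\<forall>t \<in> pverts T. card (bag t) \<le> 6"
    using edge_sum_tree_decomposition[OF assms(1)] by blast
  moreover from this have "tree_decomposition \<lparr>pverts = V, parcs = E'\<rparr> T bag"
    using assms(2) by (auto simp: tree_decomposition_def)
  ultimately show "treewidth \<lparr>pverts = V, parcs = E'\<rparr> \<le> 5"
    using treewidth_le[of _ T bag 5] by auto
qed

section \<open>Gluing triangles, paths and complete bipartite graphs\<close>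

lemma edge_sum_triangle:
  assumes "edge_sum V E" "(a, b) \<in> E" "c \<notin> V"
  shows "edge_sum (insert c V) (E \<union> {(a, b), (b, a), (a, c), (c, a), (b, c), (c, b)})"
proof -
  let ?F = "{(a, b), (b, a), (a, c), (c, a), (b, c), (c, b)}"
  have ab: "a \<noteq> b" "a \<in> V" "b \<in> V"
    using edge_sum_graph[OF assms(1)] assms(2) by (auto simp: irrefl_def)
  have "piece {a, b, c} ?F"
    by (rule piece_card_less) (use ab assms(3) in \<open>auto simp: card_insert_if sym_def irrefl_def\<close>)
  then have "edge_sum (V \<union> {a, b, c}) (E \<union> ?F)"
    by (rule edge_sum.step[OF assms(1)]) (use ab assms in auto)
  moreover have "V \<union> {a, b, c} = insert c V" using ab by auto
  ultimately show ?thesis by simp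
qed

text \<open>The path is the rim of a fan of triangles with apex \<open>b\<close>, each glued along
  the spoke from \<open>b\<close> to the current end of the path. The last spoke joins the path to
  \<open>b\<close>.\<close>

lemma edge_sum_path:
  assumes "edge_sum V E" "(p 0, b) \<in> E" "inj_on p {1..n}" "p ` {1..n} \<inter> V = {}"
  shows "\<exists>F. edge_sum (V \<union> p ` {1..n}) F \<and> E \<subseteq> F \<and> (\<forall>i<n. (p i, p (Suc i)) \<in> F) \<and> (p n, b) \<in> F"
  using assms(3,4)
proof (induction n)
  case 0
  then show ?case using assms by auto
next
  case (Suc n)
  then obtain F where F: "edge_sum (V \<union> p ` {1..n}) F" "E \<subseteq> F" "\<forall>i<n. (p i, p (Suc i)) \<in> F"
    "(p n, b) \<in> F"
    by (auto simp: atLeastAtMostSuc_conv)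
  have eq: "V \<union> p ` {1..Suc n} = insert (p (Suc n)) (V \<union> p ` {1..n})"
    by (auto simp: atLeastAtMostSuc_conv)
  have "p (Suc n) \<notin> V \<union> p ` {1..n}"
    using Suc.prems by (auto simp: atLeastAtMostSuc_conv)
  from edge_sum_triangle[OF F(1,4) this] show ?case
    unfolding eq by (intro exI conjI, assumption) (use F in \<open>auto simp: less_Suc_eq\<close>)
qed

lemma edge_sum_bipartite:
  assumes "edge_sum V E" "(l, r) \<in> E"
    and "l \<in> L" "r \<in> R" "L \<inter> R = {}" "finite L" "finite R" "card L \<le> 3" "card R \<le> 3"
    and "V \<inter> (L \<union> R) = {l, r}"
  shows "edge_sum (V \<union> (L \<union> R)) (E \<union> (L \<times> R \<union> R \<times> L))"
proof (rule edge_sum.step[OF assms(1) _ assms(2)])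
  have "card (L \<union> R) \<le> 6" using card_Un_le[of L R] assms by simp
  moreover have "\<not> clique_model I (L \<union> R) (L \<times> R \<union> R \<times> L) B" if "card I = 5" for I :: "nat set" and B
    using that assms calculation
    by (intro no_clique_model_bipartite[where c = "\<lambda>v. v \<in> L"]) (auto simp: card_ge_0_finite)
  ultimately show "piece (L \<union> R) (L \<times> R \<union> R \<times> L)"
    using assms by (auto simp: piece_def sym_def irrefl_def)
qed (use assms in auto)

section \<open>Distances\<close>

lemma awalk_imp_relpow:
  assumes "pair_wf_digraph G"
  shows "pre_digraph.awalk (with_proj G) u p v \<Longrightarrow> (u, v) \<in> parcs G ^^ length p"
proof -
  interpret pair_wf_digraph G by fact
  show "awalk u p v \<Longrightarrow> (u, v) \<in> parcs G ^^ length p"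
    by (induction p arbitrary: u) (auto simp: awalk_Nil_iff awalk_Cons_iff simp del: relpow.simps
        intro: relpow_0_I relpow_Suc_I2)
qed

lemma relpow_imp_awalk:
  assumes "pair_wf_digraph G" "u \<in> pverts G"
  shows "(u, v) \<in> parcs G ^^ n \<Longrightarrow> \<exists>p. pre_digraph.awalk (with_proj G) u p v \<and> length p = n"
proof -
  interpret pair_wf_digraph G by fact
  show "(u, v) \<in> parcs G ^^ n \<Longrightarrow> \<exists>p. awalk u p v \<and> length p = n"
    using assms(2)
  proof (induction n arbitrary: u)
    case 0
    then show ?case by (auto simp: awalk_Nil_iff)
  next
    case (Suc n)
    then obtain w where w: "(u, w) \<in> parcs G" "(w, v) \<in> parcs G ^^ n" by (meson relpow_Suc_D2)
    then obtain p where "awalk w p v" "length p = n" using Suc.IH in_arcsD2 by blast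
    then show ?case using w by (intro exI[of _ "(u, w) # p"]) (auto simp: awalk_Cons_iff)
  qed
qed

lemma graph_dist_bounds:
  assumes "pair_wf_digraph G" "u \<in> pverts G" "(u, v) \<in> parcs G ^^ n"
    and "\<And>m. (u, v) \<in> parcs G ^^ m \<Longrightarrow> l \<le> m"
  shows "real l \<le> graph_dist G u v" "graph_dist G u v \<le> real n"
proof -
  interpret pair_wf_digraph G by fact
  have cost: "awalk_cost (\<lambda>_. 1) p = real (length p)" for p :: "('a \<times> 'a) list"
    by (induction p) auto
  obtain p where p: "awalk u p v" "length p = n" using relpow_imp_awalk[OF assms(1-3)] by blast
  have "\<mu> (\<lambda>_. 1) u v \<le> ereal n"
    using min_cost_le_walk_cost[OF p(1), of "\<lambda>_. 1"] p(2) cost by simp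
  moreover have "ereal l \<le> \<mu> (\<lambda>_. 1) u v"
    unfolding \<mu>_def using assms(4) awalk_imp_relpow[OF assms(1)] by (intro INF_greatest) (auto simp: cost)
  \<comment> \<open>The two bounds exclude infinite values, for which \<open>real_of_ereal\<close>
    would return 0.\<close>
  ultimately show "real l \<le> graph_dist G u v" "graph_dist G u v \<le> real n"
    unfolding graph_dist_def by (cases "\<mu> (\<lambda>_. 1) u v"; auto)+
qed

text \<open>The source of lower bounds on distances: a 1-Lipschitz potential certifies that walks
  are long.\<close>

lemma relpow_lipschitz:
  fixes h :: "'a \<Rightarrow> int"
  assumes "\<And>x y. (x, y) \<in> E \<Longrightarrow> \<bar>h x - h y\<bar> \<le> 1" "(u, v) \<in> E ^^ n"
  shows "\<bar>h u - h v\<bar> \<le> int n"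
  using assms(2)
proof (induction n arbitrary: v)
  case (Suc n)
  then obtain w where "(u, w) \<in> E ^^ n" "(w, v) \<in> E" by auto
  then show ?case using Suc.IH[of w] assms(1)[of w v] by linarith
qed simp

section \<open>Twin trees\<close>

text \<open>
  The node \<open>path_node w 0\<close> is the node \<open>w\<close> of the first tree, and the nodes \<open>path_node w i\<close> with
  \<open>i > 0\<close> are the inner nodes of the path from there to the second tree. Children are formed by
  \<^term>\<open>(#)\<close>, so that the ancestors of a word are its suffixes.
\<close>

definition path_node :: "bool list \<Rightarrow> nat \<Rightarrow> nat" where
  "path_node w i = to_nat (Inl (w, i) :: (bool list \<times> nat) + bool list)"

definition mirror_node :: "bool list \<Rightarrow> nat" where
  "mirror_node w = to_nat (Inr w :: (bool list \<times> nat) + bool list)"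

lemma node_eq_iff [simp]:
  "path_node w i = path_node v j \<longleftrightarrow> w = v \<and> i = j"
  "mirror_node w = mirror_node v \<longleftrightarrow> w = v"
  "path_node w i \<noteq> mirror_node v" "mirror_node v \<noteq> path_node w i"
  by (auto simp: path_node_def mirror_node_def)

text \<open>What \<open>w\<close> contributes beyond itself: its children in both trees and the
  paths from the children. These have level j = \<open>length w + 1\<close>, so a path of length 2j
  has inner nodes 1 to 2j - 1 = \<open>2 * length w + 1\<close>.\<close>

definition gadget_verts :: "bool list \<Rightarrow> nat set" where
  "gadget_verts w = (\<Union>b. insert (mirror_node (b # w)) (path_node (b # w) ` {..2 * length w + 1}))"

definition gadget_arcs :: "bool list \<Rightarrow> nat rel" where
  "gadget_arcs w = (\<Union>b.
     {(path_node w 0, path_node (b # w) 0), (mirror_node w, mirror_node (b # w)),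
      (path_node (b # w) (2 * length w + 1), mirror_node ((\<not> b) # w))} \<union>
     (\<lambda>i. (path_node (b # w) i, path_node (b # w) (Suc i))) ` {..2 * length w})"

text \<open>\<open>W\<close> holds the words that have children. Leaving it arbitrary allows an
  induction that adds one gadget at a time.\<close>

definition twin_verts :: "bool list set \<Rightarrow> nat set" where
  "twin_verts W = {path_node [] 0, mirror_node []} \<union> (\<Union>w \<in> W. gadget_verts w)"

definition twin_arcs :: "bool list set \<Rightarrow> nat rel" where
  "twin_arcs W = {(path_node [] 0, mirror_node [])} \<union> (\<Union>w \<in> W. gadget_arcs w)"

text \<open>The two copies of \<open>w\<close> and their four children form a K_{3,3}. Besides the
  tree edges it has an edge from each child to the copy of its sibling, on which the fan of the path
  is built, and to its own copy, on which the gadget of the child is glued later.\<close>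

lemma gadget_edge_sum:
  assumes E: "edge_sum V E" "(path_node w 0, mirror_node w) \<in> E" "gadget_verts w \<inter> V = {}"
  shows "\<exists>F. edge_sum (V \<union> gadget_verts w) F \<and> E \<subseteq> F \<and> gadget_arcs w \<subseteq> F \<and>
    (\<forall>b. (path_node (b # w) 0, mirror_node (b # w)) \<in> F)"
proof -
  define L R where LR: "L = {path_node w 0, mirror_node (True # w), mirror_node (False # w)}"
    "R = {mirror_node w, path_node (True # w) 0, path_node (False # w) 0}"
  define V1 E1 where VE1: "V1 = V \<union> (L \<union> R)" "E1 = E \<union> (L \<times> R \<union> R \<times> L)"
  have w: "path_node w 0 \<in> V" "mirror_node w \<in> V" using edge_sum_graph(4)[OF E(1)] E(2) by auto
  have new: "mirror_node (b # w) \<notin> V" "i \<le> 2 * length w + 1 \<Longrightarrow> path_node (b # w) i \<notin> V" for b i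
    using E(3) unfolding gadget_verts_def by blast+
  have "edge_sum V1 E1"
    unfolding VE1 by (rule edge_sum_bipartite[OF E(1,2)])
      (use w new in \<open>auto simp: LR card_insert_if\<close>)
  note sum1 = this
  have E1: "(path_node (b # w) 0, mirror_node (c # w)) \<in> E1"
    "(path_node w 0, path_node (b # w) 0) \<in> E1" "(mirror_node w, mirror_node (b # w)) \<in> E1" for b c
    by (cases b; cases c; simp add: VE1 LR)+
  have inj: "inj_on (path_node v) I" for v I by (simp add: inj_on_def)
  have "path_node (True # w) ` {1..2 * length w + 1} \<inter> V1 = {}"
    using new by (auto simp: VE1 LR)
  from edge_sum_path[OF sum1 E1(1) inj this] obtain E2 where E2:
    "edge_sum (V1 \<union> path_node (True # w) ` {1..2 * length w + 1}) E2" "E1 \<subseteq> E2"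
    "\<forall>i<2 * length w + 1. (path_node (True # w) i, path_node (True # w) (Suc i)) \<in> E2"
    "(path_node (True # w) (2 * length w + 1), mirror_node (False # w)) \<in> E2"
    by blast
  define V2 where "V2 = V1 \<union> path_node (True # w) ` {1..2 * length w + 1}"
  have "path_node (False # w) ` {1..2 * length w + 1} \<inter> V2 = {}"
    using new by (auto simp: VE1 LR V2_def)
  moreover have "(path_node (False # w) 0, mirror_node (True # w)) \<in> E2"
    using E1(1) E2(2) by blast
  ultimately obtain E3 where E3:
    "edge_sum (V2 \<union> path_node (False # w) ` {1..2 * length w + 1}) E3" "E2 \<subseteq> E3"
    "\<forall>i<2 * length w + 1. (path_node (False # w) i, path_node (False # w) (Suc i)) \<in> E3"
    "(path_node (False # w) (2 * length w + 1), mirror_node (True # w)) \<in> E3"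
    using edge_sum_path[OF E2(1)[folded V2_def] _ inj] by blast
  have "{..2 * length w + 1} = insert 0 {1..2 * length w + 1}" by auto
  then have "V2 \<union> path_node (False # w) ` {1..2 * length w + 1} = V \<union> gadget_verts w"
    using w by (auto simp: V2_def VE1 LR gadget_verts_def UNIV_bool)
  moreover have "E1 \<subseteq> E3" using E2 E3 by blast
  moreover have "gadget_arcs w \<subseteq> E3"
    using E2(2-4) E3(2-4) E1 \<open>E1 \<subseteq> E3\<close> by (auto simp: gadget_arcs_def UNIV_bool)
  moreover have "E \<subseteq> E3" using \<open>E1 \<subseteq> E3\<close> by (auto simp: VE1)
  moreover have "(path_node (b # w) 0, mirror_node (b # w)) \<in> E3" for b
    using E1(1) \<open>E1 \<subseteq> E3\<close> by blast
  ultimately show ?thesis using E3(1) by metis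
qed

text \<open>Words are added in order of length, so each comes after its parent. The retained edge
  between the two copies of a child is where its own gadget is attached.\<close>

lemma twin_edge_sum:
  assumes "finite W" "\<And>b w. b # w \<in> W \<Longrightarrow> w \<in> W"
  shows "\<exists>F. edge_sum (twin_verts W) F \<and> twin_arcs W \<subseteq> F \<and>
    (\<forall>w \<in> W. \<forall>b. (path_node (b # w) 0, mirror_node (b # w)) \<in> F)"
  using assms
proof (induction W rule: finite_ranking_induct[where f = length])
  case empty
  let ?X = "{path_node [] 0, mirror_node []}"
  let ?F = "{(path_node [] 0, mirror_node []), (mirror_node [], path_node [] 0)}"
  have "piece ?X ?F"
    by (rule piece_card_less) (auto simp: sym_def irrefl_def)
  then show ?case by (auto simp: twin_verts_def twin_arcs_def intro: edge_sum.base)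
next
  case (insert x S)
  show ?case
  proof (cases "x \<in> S")
    case True
    then show ?thesis using insert by (simp add: insert_absorb)
  next
    case False
    \<comment> \<open>The parent of a word in \<open>S\<close> is not \<open>x\<close>, because
      \<open>x\<close> is at least as long as every word in \<open>S\<close>.\<close>
    have closed: "w \<in> S" if "b # w \<in> S" for b w
      using insert.prems[of b w] insert.hyps(2)[OF that] that by auto
    obtain F where F: "edge_sum (twin_verts S) F" "twin_arcs S \<subseteq> F"
      "\<forall>w \<in> S. \<forall>b. (path_node (b # w) 0, mirror_node (b # w)) \<in> F"
      using insert.IH closed by blast
    have "(path_node x 0, mirror_node x) \<in> F"
    proof (cases x)
      case Nil
      then show ?thesis using F(2) by (auto simp: twin_arcs_def)
    next
      case (Cons b w)
      then show ?thesis using F(3) insert.prems[of b w] by auto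
    qed
    moreover have "gadget_verts x \<inter> twin_verts S = {}"
      using False by (auto simp: gadget_verts_def twin_verts_def)
    ultimately obtain F' where F': "edge_sum (twin_verts S \<union> gadget_verts x) F'" "F \<subseteq> F'"
      "gadget_arcs x \<subseteq> F'" "\<forall>b. (path_node (b # x) 0, mirror_node (b # x)) \<in> F'"
      using gadget_edge_sum[OF F(1)] by blast
    have "twin_verts (insert x S) = twin_verts S \<union> gadget_verts x"
      by (auto simp: twin_verts_def)
    moreover have "twin_arcs (insert x S) \<subseteq> F'"
      using F(2) F'(2,3) by (auto simp: twin_arcs_def)
    ultimately show ?thesis using F(3) F' by (intro exI[of _ F']) auto
  qed
qed

text \<open>The leaves are the words of length \<open>k\<close>, which have no gadget. The gluing
  edges are left out, since with them the two copies of a leaf would be adjacent.\<close>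

definition twin_tree :: "nat \<Rightarrow> nat pair_pre_digraph" where
  "twin_tree k = \<lparr>pverts = twin_verts {w. length w < k},
     parcs = twin_arcs {w. length w < k} \<union> (twin_arcs {w. length w < k})\<inverse>\<rparr>"

lemma sym_twin_tree: "sym (parcs (twin_tree k))"
  by (simp add: twin_tree_def sym_Un_converse)

lemma
  shows pair_graph_twin_tree: "pair_graph (twin_tree k)"
    and complete_minor_free_twin_tree: "complete_minor_free 5 (twin_tree k)"
    and treewidth_twin_tree: "treewidth (twin_tree k) \<le> 5"
proof -
  let ?W = "{w :: bool list. length w < k}"
  have "finite {w :: bool list. set w \<subseteq> UNIV \<and> length w \<le> k}"
    by (rule finite_lists_length_le) simp
  then have "finite ?W" by (rule rev_finite_subset) auto
  then obtain F where F: "edge_sum (twin_verts ?W) F" "twin_arcs ?W \<subseteq> F"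
    using twin_edge_sum[of ?W] by auto
  note graph = edge_sum_graph[OF F(1)]
  have sub: "parcs (twin_tree k) \<subseteq> F"
    using F(2) graph(2) by (auto simp: twin_tree_def dest: symD)
  have V: "twin_tree k = \<lparr>pverts = twin_verts ?W, parcs = parcs (twin_tree k)\<rparr>"
    by (simp add: twin_tree_def)
  show "pair_graph (twin_tree k)"
    by (subst V, rule pair_graphI) (use graph sub sym_twin_tree in \<open>auto simp: irrefl_def\<close>)
  show "complete_minor_free 5 (twin_tree k)" "treewidth (twin_tree k) \<le> 5"
    using subgraph_edge_sum[OF F(1) sub sym_twin_tree] V by metis+
qed

lemma pair_wf_digraph_twin_tree: "pair_wf_digraph (twin_tree k)"
  using pair_graph_twin_tree by (simp add: pair_graph_def pair_digraph_def pair_fin_digraph_def)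

lemma twin_tree_arcs:
  "(path_node [] 0, mirror_node []) \<in> parcs (twin_tree k)"
  "length w < k \<Longrightarrow> (path_node (b # w) 0, path_node w 0) \<in> parcs (twin_tree k)"
  "length w < k \<Longrightarrow> (mirror_node (b # w), mirror_node w) \<in> parcs (twin_tree k)"
  "length w < k \<Longrightarrow> (path_node (b # w) (2 * length w + 1), mirror_node ((\<not> b) # w)) \<in> parcs (twin_tree k)"
  "length w < k \<Longrightarrow> i \<le> 2 * length w \<Longrightarrow>
    (path_node (b # w) i, path_node (b # w) (Suc i)) \<in> parcs (twin_tree k)"
  unfolding twin_tree_def by (auto simp: twin_arcs_def gadget_arcs_def intro!: bexI)

section \<open>Walks and connectedness of the twin trees\<close>

lemma relpow_sym:
  assumes "sym E" "(u, v) \<in> E ^^ n"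
  shows "(v, u) \<in> E ^^ n"
  using assms(2)
proof (induction n arbitrary: v)
  case (Suc n)
  then obtain w where "(u, w) \<in> E ^^ n" "(w, v) \<in> E" by auto
  then show ?case using Suc.IH assms(1) by (meson relpow_Suc_I2 symD)
qed simp

lemma relpow_trans: "(u, v) \<in> E ^^ m \<Longrightarrow> (v, w) \<in> E ^^ n \<Longrightarrow> (u, w) \<in> E ^^ (m + n)"
  by (auto simp: relpow_add)

lemma walk_to_ancestor:
  assumes "length (v @ w) \<le> k"
  shows "(path_node (v @ w) 0, path_node w 0) \<in> parcs (twin_tree k) ^^ length v"
    and "(mirror_node (v @ w), mirror_node w) \<in> parcs (twin_tree k) ^^ length v"
  using assms
  by (induction v) (auto simp del: relpow.simps intro: relpow_0_I
    intro!: relpow_Suc_I2[OF twin_tree_arcs(2)] relpow_Suc_I2[OF twin_tree_arcs(3)])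

lemma walk_along_path:
  assumes "length w < k" "i \<le> 2 * length w + 1"
  shows "(path_node (b # w) 0, path_node (b # w) i) \<in> parcs (twin_tree k) ^^ i"
  using assms(2)
proof (induction i)
  case (Suc i)
  then show ?case using twin_tree_arcs(5)[OF assms(1), of i b] by auto
qed simp

lemma connected_twin_tree: "connected (with_proj (twin_tree k))"
proof -
  let ?E = "parcs (twin_tree k)"
  have sub: "?E \<subseteq> pverts (twin_tree k) \<times> pverts (twin_tree k)"
    using pair_graphD(4)[OF pair_graph_twin_tree] .
  have up: "(path_node w 0, path_node [] 0) \<in> ?E\<^sup>*" "(mirror_node w, path_node [] 0) \<in> ?E\<^sup>*"
    if "length w \<le> k" for w
  proof -
    show "(path_node w 0, path_node [] 0) \<in> ?E\<^sup>*"
      using walk_to_ancestor(1)[of w "[]"] that by (auto dest: relpow_imp_rtrancl)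
    have "(mirror_node w, mirror_node []) \<in> ?E\<^sup>*"
      using walk_to_ancestor(2)[of w "[]"] that by (auto dest: relpow_imp_rtrancl)
    also have "(mirror_node [], path_node [] 0) \<in> ?E"
      using twin_tree_arcs(1) sym_twin_tree by (meson symD)
    finally show "(mirror_node w, path_node [] 0) \<in> ?E\<^sup>*" .
  qed
  have "(v, path_node [] 0) \<in> ?E\<^sup>*" if v: "v \<in> pverts (twin_tree k)" for v
  proof -
    consider w where "length w \<le> k" "v \<in> {path_node w 0, mirror_node w}"
      | b w i where "length w < k" "i \<le> 2 * length w + 1" "v = path_node (b # w) i"
      using v by (fastforce simp: twin_tree_def twin_verts_def gadget_verts_def)
    then show ?thesis
    proof cases
      case 1
      then show ?thesis using up by blast
    next
      case 2
      then have "(v, path_node (b # w) 0) \<in> ?E\<^sup>*"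
        using relpow_sym[OF sym_twin_tree walk_along_path] relpow_imp_rtrancl by metis
      then show ?thesis using up(1)[of "b # w"] 2 by simp
    qed
  qed
  then show ?thesis
    using cut_connected_if_rtrancl[OF sym_twin_tree sub, of "path_node [] 0"]
    by (subst connected_iff_cut_connected[OF sym_twin_tree sub]) (simp add: twin_tree_def twin_verts_def)
qed

section \<open>The metric of the twin trees\<close>

text \<open>The sibling of a word; the root has none and is fixed, so that \<open>potential\<close>
  needs no special case.\<close>

fun flip :: "bool list \<Rightarrow> bool list" where
  "flip [] = []"
| "flip (b # w) = (\<not> b) # w"

text \<open>Zero at \<open>x\<close> and growing by one per step towards the root. Because of the 2,
  stepping from an ancestor of \<open>x\<close> down to a non-ancestor is an increase by one as
  well; further descents decrease it again.\<close>

definition height :: "bool list \<Rightarrow> bool list \<Rightarrow> int" where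
  "height x w = int (length x) - int (length w) + (if suffix w x then 0 else 2)"

text \<open>
  The potential \<open>height x\<close> on the first tree and its mirror image on the second one,
  extended to the paths between the two trees by the largest 1-Lipschitz function. It bounds the
  distance between the two copies of \<open>x\<close> from below.
\<close>

definition potential :: "bool list \<Rightarrow> nat \<Rightarrow> int" where
  "potential x n = (case from_nat n :: (bool list \<times> nat) + bool list of
     Inl (w, i) \<Rightarrow> min (height x w + int i)
       (2 * int (length x) + 1 - height x (flip w) + 2 * int (length w) - int i)
   | Inr w \<Rightarrow> 2 * int (length x) + 1 - height x w)"

lemma potential_simps:
  "potential x (path_node w i) = min (height x w + int i)
     (2 * int (length x) + 1 - height x (flip w) + 2 * int (length w) - int i)"
  "potential x (mirror_node w) = 2 * int (length x) + 1 - height x w"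
  by (simp_all add: potential_def path_node_def mirror_node_def)

text \<open>At most one of two siblings is an ancestor of \<open>x\<close>, so the 2 enters the sum
  once or twice. The lower bound controls the potential where a path reaches the second tree, the
  upper bound where it starts in the first.\<close>

lemma height_flip:
  "2 * (int (length x) - int (length w)) \<le> height x (b # w) + height x ((\<not> b) # w)"
  "height x (b # w) + height x ((\<not> b) # w) \<le> 2 * (int (length x) - int (length w)) + 2"
proof -
  have "\<not> (suffix (b # w) x \<and> suffix ((\<not> b) # w) x)"
    by (auto simp: suffix_def)
  then show "2 * (int (length x) - int (length w)) \<le> height x (b # w) + height x ((\<not> b) # w)"
    "height x (b # w) + height x ((\<not> b) # w) \<le> 2 * (int (length x) - int (length w)) + 2"
    by (auto simp: height_def)
qed

lemma height_Cons: "\<bar>height x w - height x (b # w)\<bar> \<le> 1"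
  using suffix_ConsD[of b w x] by (auto simp: height_def)

lemma potential_path_node_0:
  "length w \<le> length x \<Longrightarrow> potential x (path_node w 0) = height x w"
  using height_flip(2)[of x "hd w" "tl w"]
  by (cases w) (auto simp: potential_simps height_def)

lemma potential_lipschitz:
  assumes "(u, v) \<in> parcs (twin_tree (length x))"
  shows "\<bar>potential x u - potential x v\<bar> \<le> 1"
proof -
  have "\<bar>potential x u - potential x v\<bar> \<le> 1"
    if arc: "(u, v) \<in> gadget_arcs w" and w: "length w < length x" for u v w
  proof -
    obtain b where "(u, v) = (path_node w 0, path_node (b # w) 0) \<or>
      (u, v) = (mirror_node w, mirror_node (b # w)) \<or>
      (u, v) = (path_node (b # w) (2 * length w + 1), mirror_node ((\<not> b) # w)) \<or>
      (\<exists>i. (u, v) = (path_node (b # w) i, path_node (b # w) (Suc i)))"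
      using arc unfolding gadget_arcs_def by blast
    then consider "u = path_node w 0" "v = path_node (b # w) 0"
      | "u = mirror_node w" "v = mirror_node (b # w)"
      | "u = path_node (b # w) (2 * length w + 1)" "v = mirror_node ((\<not> b) # w)"
      | i where "u = path_node (b # w) i" "v = path_node (b # w) (Suc i)"
      by blast
    then show ?thesis
    proof cases
      case 1
      then show ?thesis using w height_Cons[of x w b] by (simp add: potential_path_node_0)
    next
      case 2
      then show ?thesis using height_Cons[of x w b] by (simp add: potential_simps)
    next
      case 3
      \<comment> \<open>At the last inner node the second argument of the minimum is the mirror
        value plus one, and by the sibling bound the first is at least the mirror value.\<close>
      then show ?thesis using height_flip(1)[of x w b] by (simp add: potential_simps)
    next
      case 4
      \<comment> \<open>Both arguments of the minimum change by one along a path, so the minimum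
        changes by at most one.\<close>
      then show ?thesis by (simp add: potential_simps)
    qed
  qed
  moreover have "\<bar>potential x (path_node [] 0) - potential x (mirror_node [])\<bar> \<le> 1"
    by (simp add: potential_simps height_def)
  ultimately show ?thesis
    using assms unfolding twin_tree_def twin_arcs_def
    by (fastforce simp: abs_minus_commute)
qed


section \<open>Leaves and their distances\<close>

definition leaves :: "nat \<Rightarrow> nat set" where
  "leaves k = (\<lambda>w. path_node w 0) ` {w. length w = k} \<union> mirror_node ` {w. length w = k}"

lemma card_leaves: "card (leaves k) = 2 ^ Suc k"
proof -
  let ?W = "{w :: bool list. length w = k}"
  have W: "card ?W = 2 ^ k" "finite ?W"
    using card_lists_length_eq[of "UNIV :: bool set" k] finite_lists_length_eq[of "UNIV :: bool set" k]
    by simp_all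
  have "card (leaves k) = card ((\<lambda>w. path_node w 0) ` ?W) + card (mirror_node ` ?W)"
    unfolding leaves_def using W(2) by (intro card_Un_disjoint) auto
  also have "\<dots> = 2 ^ Suc k"
    using W by (simp add: card_image inj_on_def)
  finally show ?thesis .
qed

lemma leaves_subset: "leaves k \<subseteq> pverts (twin_tree k)"
proof -
  have "path_node w 0 \<in> pverts (twin_tree k) \<and> mirror_node w \<in> pverts (twin_tree k)"
    if "length w = k" for w
    using that by (cases w) (auto simp: twin_tree_def twin_verts_def gadget_verts_def)
  then show ?thesis by (auto simp: leaves_def)
qed

text \<open>By way of the roots there are \<open>k\<close> arcs up and \<open>k\<close> arcs down,
  plus the root edge when the tree changes. Copies of different words avoid the root edge by
  crossing where the words split.\<close>

lemma walk_between_leaves: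
  assumes "length w = k" "length v = k"
  shows "(path_node w 0, path_node v 0) \<in> parcs (twin_tree k) ^^ (2 * k)"
    and "(mirror_node w, mirror_node v) \<in> parcs (twin_tree k) ^^ (2 * k)"
    and "w \<noteq> v \<Longrightarrow> (path_node w 0, mirror_node v) \<in> parcs (twin_tree k) ^^ (2 * k)"
    and "(path_node w 0, mirror_node v) \<in> parcs (twin_tree k) ^^ (2 * k + 1)"
proof -
  note up = walk_to_ancestor
  note down = walk_to_ancestor[THEN relpow_sym[OF sym_twin_tree]]
  show "(path_node w 0, path_node v 0) \<in> parcs (twin_tree k) ^^ (2 * k)"
    using relpow_trans[OF up(1)[of w "[]" k] down(1)[of v "[]" k]] assms by (simp add: mult_2)
  show "(mirror_node w, mirror_node v) \<in> parcs (twin_tree k) ^^ (2 * k)"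
    using relpow_trans[OF up(2)[of w "[]" k] down(2)[of v "[]" k]] assms by (simp add: mult_2)
  have "(path_node [] 0, mirror_node []) \<in> parcs (twin_tree k) ^^ 1"
    using twin_tree_arcs(1) by simp
  from relpow_trans[OF relpow_trans[OF up(1)[of w "[]" k] this] down(2)[of v "[]" k]]
  show "(path_node w 0, mirror_node v) \<in> parcs (twin_tree k) ^^ (2 * k + 1)"
    using assms by (simp add: mult_2 del: relpow.simps)
  assume "w \<noteq> v"
  obtain z w' v' where wv: "w = w' @ z" "v = v' @ z" "w' = [] \<or> v' = [] \<or> last w' \<noteq> last v'"
    using longest_common_suffix[of w v] by blast
  have "w' \<noteq> []" "v' \<noteq> []" using wv assms \<open>w \<noteq> v\<close> by auto
  then obtain x b y c where "w' = x @ [b]" "v' = y @ [c]" by (meson rev_exhaust)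
  \<comment> \<open>The suffix \<open>z\<close> is longest, so the letters before it differ; for
    Booleans \<open>c\<close> is then the negation of \<open>b\<close>.\<close>
  then have w: "w = x @ b # z" and v: "v = y @ (\<not> b) # z" using wv by auto
  have z: "length z < k" using w assms by simp
  have "(path_node (b # z) 0, mirror_node ((\<not> b) # z)) \<in>
      parcs (twin_tree k) ^^ Suc (2 * length z + 1)"
    by (rule relpow_Suc_I[OF walk_along_path[OF z order_refl] twin_tree_arcs(4)[OF z]])
  from relpow_trans[OF relpow_trans[OF up(1)[of x "b # z" k] this] down(2)[of y "(\<not> b) # z" k]]
  have "(path_node w 0, mirror_node v) \<in>
      parcs (twin_tree k) ^^ (length x + Suc (2 * length z + 1) + length y)"
    using w v assms by simp
  \<comment> \<open>\<open>x\<close> and \<open>y\<close> have length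
    \<open>k - length z - 1\<close> and the crossing has \<open>2 * (length z + 1)\<close> arcs, so
    the level cancels.\<close>
  moreover have "length x + Suc (2 * length z + 1) + length y = 2 * k"
    using w v assms by auto
  ultimately show "(path_node w 0, mirror_node v) \<in> parcs (twin_tree k) ^^ (2 * k)"
    by (simp only:)
qed

lemma dist_antipodal_leaves:
  assumes "length w = k"
  shows "real (2 * k + 1) \<le> graph_dist (twin_tree k) (path_node w 0) (mirror_node w)"
    and "real (2 * k + 1) \<le> graph_dist (twin_tree k) (mirror_node w) (path_node w 0)"
proof -
  have V: "path_node w 0 \<in> pverts (twin_tree k)" "mirror_node w \<in> pverts (twin_tree k)"
    using leaves_subset[of k] assms by (auto simp: leaves_def)
  \<comment> \<open>The potential is 0 at the leaf in the first tree and \<open>2 * k + 1\<close> at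
    its copy.\<close>
  have "\<bar>potential w (path_node w 0) - potential w (mirror_node w)\<bar> = 2 * int k + 1"
    using assms by (simp add: potential_path_node_0) (simp add: potential_simps height_def)
  moreover have "\<bar>potential w (path_node w 0) - potential w (mirror_node w)\<bar> \<le> int m"
    if "(path_node w 0, mirror_node w) \<in> parcs (twin_tree k) ^^ m" for m
    by (rule relpow_lipschitz[OF _ that]) (use potential_lipschitz assms in blast)
  ultimately have lower: "2 * k + 1 \<le> m"
    if "(path_node w 0, mirror_node w) \<in> parcs (twin_tree k) ^^ m" for m
    using that by fastforce
  note walk = walk_between_leaves(4)[OF assms assms]
  show "real (2 * k + 1) \<le> graph_dist (twin_tree k) (path_node w 0) (mirror_node w)"
    by (rule graph_dist_bounds(1)[OF pair_wf_digraph_twin_tree V(1) walk lower])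
  show "real (2 * k + 1) \<le> graph_dist (twin_tree k) (mirror_node w) (path_node w 0)"
    by (rule graph_dist_bounds(1)[OF pair_wf_digraph_twin_tree V(2) relpow_sym[OF sym_twin_tree walk]
          lower[OF relpow_sym[OF sym_twin_tree]]])
qed

text \<open>The witness for \<open>p\<close> is the other copy of the same word. Every leaf except
  \<open>p\<close>, the witness included, is reached from it by a walk of exactly
  \<open>2 * k\<close> arcs.\<close>

lemma furthest_leaf:
  assumes "p \<in> leaves k"
  shows "\<exists>v \<in> leaves k. real (2 * k + 1) \<le> graph_dist (twin_tree k) v p \<and>
    (\<forall>q \<in> leaves k. q \<noteq> p \<longrightarrow> graph_dist (twin_tree k) v q \<le> real (2 * k))"
proof -
  have near: "graph_dist (twin_tree k) v q \<le> real (2 * k)"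
    if "v \<in> leaves k" "(v, q) \<in> parcs (twin_tree k) ^^ (2 * k)" for v q
    using graph_dist_bounds(2)[OF pair_wf_digraph_twin_tree _ that(2), of 0] leaves_subset that(1) by blast
  obtain w where w: "length w = k" "p = path_node w 0 \<or> p = mirror_node w"
    using assms by (auto simp: leaves_def)
  have leaf: "path_node w 0 \<in> leaves k" "mirror_node w \<in> leaves k"
    using w(1) by (auto simp: leaves_def)
  from w(2) show ?thesis
  proof
    assume p: "p = path_node w 0"
    have "graph_dist (twin_tree k) (mirror_node w) q \<le> real (2 * k)"
      if "q \<in> leaves k" "q \<noteq> p" for q
    proof (rule near[OF leaf(2)])
      show "(mirror_node w, q) \<in> parcs (twin_tree k) ^^ (2 * k)"
        using that w(1) walk_between_leaves(2)
          relpow_sym[OF sym_twin_tree walk_between_leaves(3)]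
        by (auto simp: leaves_def p)
    qed
    then show ?thesis using dist_antipodal_leaves(2)[OF w(1)] leaf p by blast
  next
    assume p: "p = mirror_node w"
    have "graph_dist (twin_tree k) (path_node w 0) q \<le> real (2 * k)"
      if "q \<in> leaves k" "q \<noteq> p" for q
    proof (rule near[OF leaf(1)])
      show "(path_node w 0, q) \<in> parcs (twin_tree k) ^^ (2 * k)"
        using that w(1) walk_between_leaves(1,3) by (auto simp: leaves_def p)
    qed
    then show ?thesis using dist_antipodal_leaves(1)[OF w(1)] leaf p by blast
  qed
qed

text \<open>From the witness of a leaf \<open>p\<close>, the coreset must offer a leaf at distance
  more than \<open>2 * k\<close>, and only \<open>p\<close> is that far.\<close>

lemma coreset_of_leaves:
  assumes \<epsilon>: "\<epsilon> * (2 * real k + 1) < 1" "\<epsilon> < 1"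
    and Q: "furthest_neighbor_coreset (pverts (twin_tree k)) (graph_dist (twin_tree k)) \<epsilon> (leaves k) Q"
  shows "Q = leaves k"
proof
  show "Q \<subseteq> leaves k" using Q by (simp add: furthest_neighbor_coreset_def)
  show "leaves k \<subseteq> Q"
  proof
    fix p assume p: "p \<in> leaves k"
    let ?d = "graph_dist (twin_tree k)"
    obtain v where v: "v \<in> leaves k" "real (2 * k + 1) \<le> ?d v p"
      "\<And>q. q \<in> leaves k \<Longrightarrow> q \<noteq> p \<Longrightarrow> ?d v q \<le> real (2 * k)"
      using furthest_leaf[OF p] by blast
    obtain q where q: "q \<in> Q" "(1 - \<epsilon>) * (MAX p \<in> leaves k. ?d v p) \<le> ?d v q"
      using Q v(1) leaves_subset by (fastforce simp: furthest_neighbor_coreset_def)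
    have "finite (leaves k)" by (rule card_ge_0_finite) (simp add: card_leaves)
    then have "?d v p \<le> (MAX p \<in> leaves k. ?d v p)" using p by simp
    then have "(1 - \<epsilon>) * (2 * real k + 1) \<le> (1 - \<epsilon>) * (MAX p \<in> leaves k. ?d v p)"
      using v(2) \<epsilon>(2) by (intro mult_left_mono) auto
    moreover have "2 * real k < (1 - \<epsilon>) * (2 * real k + 1)"
      using \<epsilon>(1) by (simp add: algebra_simps)
    ultimately have "2 * real k < ?d v q" using q(2) by linarith
    then have "q = p" using v(3)[of q] q(1) \<open>Q \<subseteq> leaves k\<close> by fastforce
    then show "p \<in> Q" using q(1) by simp
  qed
qed

section \<open>Choice of the constant and of the tree height\<close>

theorem corollary1p8:
  shows "\<exists>c :: real. c > 0 \<and>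
    (\<forall>\<epsilon> :: real. 0 < \<epsilon> \<and> \<epsilon> < 1 \<longrightarrow>
      (\<exists>(G :: nat pair_pre_digraph) (P :: nat set).
         pair_graph G \<and> connected (with_proj G) \<and>
         complete_minor_free 5 G \<and> treewidth G \<le> 5 \<and>
         P \<subseteq> pverts G \<and> P \<noteq> {} \<and>
         (\<forall>Q. furthest_neighbor_coreset (pverts G) (graph_dist G) \<epsilon> P Q \<longrightarrow>
              2 powr (c / \<epsilon>) \<le> real (card Q))))"
proof (rule exI[of _ "1 / 3"], intro conjI allI impI)
  fix \<epsilon> :: real assume \<epsilon>: "0 < \<epsilon> \<and> \<epsilon> < 1"
  define t where "t = 1 / \<epsilon>"
  \<comment> \<open>The largest \<open>k\<close> with \<open>3 * k < t\<close>. Maximality gives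
    \<open>t / 3 \<le> k + 1\<close>, hence the constant 1/3 in the exponent.\<close>
  define k where "k = nat (\<lceil>t / 3\<rceil> - 1)"
  have t: "1 < t" "\<epsilon> * t = 1" using \<epsilon> by (auto simp: t_def)
  have "0 < \<lceil>t / 3\<rceil>" using t by simp
  then have "real k + 1 = of_int \<lceil>t / 3\<rceil>" by (simp add: k_def)
  then have k: "t / 3 \<le> real k + 1" "real k < t / 3" by linarith+
  \<comment> \<open>For \<open>k \<ge> 1\<close> this is \<open>2 * k + 1 \<le> 3 * k < t\<close>;
    for \<open>k = 0\<close>, where the graph is a single edge, it is \<open>1 < t\<close>.\<close>
  have "2 * real k + 1 < t" using k(2) t(1) by (cases "k = 0") auto
  then have "\<epsilon> * (2 * real k + 1) < 1" using \<epsilon> t(2) by (metis mult_strict_left_mono)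
  then have Q: "Q = leaves k"
    if "furthest_neighbor_coreset (pverts (twin_tree k)) (graph_dist (twin_tree k)) \<epsilon> (leaves k) Q" for Q
    using coreset_of_leaves \<epsilon> that by blast
  have "(2 :: real) powr (1 / 3 / \<epsilon>) \<le> 2 powr (real (Suc k))"
    using k(1) by (intro powr_mono) (auto simp: t_def)
  also have "\<dots> = real (card (leaves k))"
    by (simp add: card_leaves powr_realpow del: of_nat_Suc)
  finally have card: "2 powr (1 / 3 / \<epsilon>) \<le> real (card (leaves k))" .
  have "leaves k \<noteq> {}" using card_leaves[of k] by force
  then show "\<exists>(G :: nat pair_pre_digraph) (P :: nat set).
         pair_graph G \<and> connected (with_proj G) \<and>
         complete_minor_free 5 G \<and> treewidth G \<le> 5 \<and>
         P \<subseteq> pverts G \<and> P \<noteq> {} \<and>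
         (\<forall>Q. furthest_neighbor_coreset (pverts G) (graph_dist G) \<epsilon> P Q \<longrightarrow>
              2 powr (1 / 3 / \<epsilon>) \<le> real (card Q))"
    using pair_graph_twin_tree connected_twin_tree complete_minor_free_twin_tree
      treewidth_twin_tree leaves_subset Q card
    by (intro exI[of _ "twin_tree k"] exI[of _ "leaves k"]) blast
qed simp

end
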